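(* Let $L$ be a locally compact topological loop and let $\mu$ be a Radon measure on $L$ that is left quasi-invariant (i.e. quasi-invariant under every left translation $L_a$, $a\in L$), with left modular cocycle $\lambda(a,\cdot)=\frac{d(L_a)_*\mu}{d\mu}$. Let $\mathcal{I}$ be a family of loop identities satisfied by $L$, and let $P\subseteq L\times L$ be a set of pairs such that the identities in $\mathcal{I}$ imply $\Phi_{a,b}=\mathrm{id}_L$ for every $(a,b)\in P$, where $\Phi_{a,b}=L_a\circ L_b\circ L_{ab}^{-1}$. Then for every $(a,b)\in P$ and for $\mu$-almost every $x\in L$, $$\lambda(a,x)\,\lambda\bigl(b,L_a^{-1}x\bigr)=\lambda(ab,x).$$
   Context: A loop is a set $L$ with a binary operation $(x,y)\mapsto xy$ and an element $e\in L$ with $ex=xe=x$ for all $x\in L$, such that for all $a,b\in L$ the equations $ax=b$ and $ya=b$ have unique solutions $x,y\in L$. A topological loop is a loop with a Hausdorff topology for which multiplication and the left and right division operations (the maps sending $(a,b)$ to the unique solution of $ax=b$, respectively of $ya=b$) are continuous maps $L\times L\to L$. For $a\in L$ the left translation is $L_a:L\to L$, $L_a(x)=ax$; it is a homeomorphism of $L$, and $L_a^{-1}$ denotes its inverse map. The map $\Phi_{a,b}=L_a\circ L_b\circ L_{ab}^{-1}$ is called the associativity deviation homeomorphism of $a,b$. The family $\mathcal{I}$ enters only through the resulting equalities $\Phi_{a,b}=\mathrm{id}_L$ for $(a,b)\in P$. A Radon measure is a Borel measure that is finite on compact sets and inner regular with respect to compact sets on all Borel sets. For a homeomorphism $f:L\to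 L$, the pushforward is $f_*\mu(E)=\mu(f^{-1}(E))$. The measure $\mu$ is called quasi-invariant under $f$ if $f_*\mu\ll\mu$ with a positive measurable Radon--Nikodym derivative, i.e. there is a measurable function $\frac{df_*\mu}{d\mu}:L\to\mathbb{R}_{>0}$ with $f_*\mu(E)=\int_E\frac{df_*\mu}{d\mu}\,d\mu$ for all Borel sets $E$. For each $a\in L$, $\lambda(a,\cdot):L\to\mathbb{R}_{>0}$ denotes a fixed choice of the derivative for $f=L_a$. *)

theory Defs
  imports "HOL-Analysis.Analysis"
begin

text \<open>
  The underlying set of the loop is the whole type. Divisions are the operations sending
  \<open>(a, b)\<close> to the solution of \<open>a x = b\<close>, respectively of \<open>y a = b\<close>; both take \<open>a\<close> first.
\<close>

definition loop_ldiv :: "('a \<Rightarrow> 'a \<Rightarrow> 'a) \<Rightarrow> 'a \<Rightarrow> 'a \<Rightarrow> 'a" where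
  "loop_ldiv mul a b = (THE x. mul a x = b)"

definition loop_rdiv :: "('a \<Rightarrow> 'a \<Rightarrow> 'a) \<Rightarrow> 'a \<Rightarrow> 'a \<Rightarrow> 'a" where
  "loop_rdiv mul a b = (THE y. mul y a = b)"

locale algebraic_loop =
  fixes mul :: "'a \<Rightarrow> 'a \<Rightarrow> 'a" and e :: 'a
  assumes left_unit: "mul e x = x"
    and right_unit: "mul x e = x"
    and ex1_left_solution: "\<exists>!x. mul a x = b"
    and ex1_right_solution: "\<exists>!y. mul y a = b"

locale topological_loop = algebraic_loop mul e
  for mul :: "'a::t2_space \<Rightarrow> 'a \<Rightarrow> 'a" and e :: 'a +
  assumes continuous_mul: "continuous_on UNIV (\<lambda>(a, b). mul a b)"
    and continuous_ldiv: "continuous_on UNIV (\<lambda>(a, b). loop_ldiv mul a b)"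
    and continuous_rdiv: "continuous_on UNIV (\<lambda>(a, b). loop_rdiv mul a b)"

text \<open>The left translation \<open>L\<^sub>a\<close> is the partial application \<open>mul a\<close>.\<close>

definition assoc_deviation :: "('a \<Rightarrow> 'a \<Rightarrow> 'a) \<Rightarrow> 'a \<Rightarrow> 'a \<Rightarrow> 'a \<Rightarrow> 'a" where
  "assoc_deviation mul a b = mul a \<circ> mul b \<circ> inv (mul (mul a b))"

text \<open>
  Loop identities are pairs of terms in the signature of loops, with variables indexed by
  natural numbers; they hold in a loop if both sides agree under every assignment.
\<close>

datatype loop_term =
    LVar nat
  | LUnit
  | LMul loop_term loop_term
  | LLdiv loop_term loop_term
  | LRdiv loop_term loop_term

primrec loop_term_value ::
  "('a \<Rightarrow> 'a \<Rightarrow> 'a) \<Rightarrow> 'a \<Rightarrow> (nat \<Rightarrow> 'a) \<Rightarrow> loop_term \<Rightarrow> 'a" where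
  "loop_term_value mul e v (LVar n) = v n"
| "loop_term_value mul e v LUnit = e"
| "loop_term_value mul e v (LMul s t) = mul (loop_term_value mul e v s) (loop_term_value mul e v t)"
| "loop_term_value mul e v (LLdiv s t) =
     loop_ldiv mul (loop_term_value mul e v s) (loop_term_value mul e v t)"
| "loop_term_value mul e v (LRdiv s t) =
     loop_rdiv mul (loop_term_value mul e v s) (loop_term_value mul e v t)"

definition satisfies_identities ::
  "('a \<Rightarrow> 'a \<Rightarrow> 'a) \<Rightarrow> 'a \<Rightarrow> (loop_term \<times> loop_term) set \<Rightarrow> bool" where
  "satisfies_identities mul e I \<longleftrightarrow>
     (\<forall>(s, t)\<in>I. \<forall>v. loop_term_value mul e v s = loop_term_value mul e v t)"

text \<open>Neither \<open>\<sigma>\<close>-finiteness nor outer regularity is part of the definition.\<close>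

definition radon_measure :: "'a::t2_space measure \<Rightarrow> bool" where
  "radon_measure \<mu> \<longleftrightarrow>
     sets \<mu> = sets borel \<and>
     (\<forall>K. compact K \<longrightarrow> emeasure \<mu> K < \<infinity>) \<and>
     (\<forall>B\<in>sets borel. emeasure \<mu> B = (SUP K\<in>{K. compact K \<and> K \<subseteq> B}. emeasure \<mu> K))"

text \<open>
  \<open>r\<close> is a version of \<open>df\<^sub>*\<mu>/d\<mu>\<close> that is positive and finite everywhere. The library's
  \<open>RN_deriv\<close> picks one unspecified \<open>ennreal\<close>-valued version, whereas here any version may be fixed.
\<close>

definition pushforward_derivative ::
  "'a::topological_space measure \<Rightarrow> ('a \<Rightarrow> 'a) \<Rightarrow> ('a \<Rightarrow> real) \<Rightarrow> bool" where
  "pushforward_derivative \<mu> f r \<longleftrightarrow>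
     r \<in> borel_measurable borel \<and>
     (\<forall>x. 0 < r x) \<and>
     (\<forall>E\<in>sets borel. emeasure (distr \<mu> borel f) E = (\<integral>\<^sup>+x\<in>E. ennreal (r x) \<partial>\<mu>))"

definition quasi_invariant :: "'a::topological_space measure \<Rightarrow> ('a \<Rightarrow> 'a) \<Rightarrow> bool" where
  "quasi_invariant \<mu> f \<longleftrightarrow>
     absolutely_continuous \<mu> (distr \<mu> borel f) \<and> (\<exists>r. pushforward_derivative \<mu> f r)"

definition left_quasi_invariant :: "('a \<Rightarrow> 'a \<Rightarrow> 'a) \<Rightarrow> 'a::topological_space measure \<Rightarrow> bool" where
  "left_quasi_invariant mul \<mu> \<longleftrightarrow> (\<forall>a. quasi_invariant \<mu> (mul a))"

end

theory Submission
  imports Defs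
begin

text \<open>
  If \<open>\<Phi>\<^sub>a\<^sub>,\<^sub>b\<close> is the identity, then \<open>L\<^sub>a\<^sub>b = L\<^sub>a \<circ> L\<^sub>b\<close>, so the pushforward of \<open>\<mu>\<close> under \<open>L\<^sub>a\<^sub>b\<close> can be
  computed in two steps. The chain rule for densities (\<open>pushforward_derivative_comp\<close>) shows that
  both sides of the cocycle equation are versions of the same derivative.

  It remains to see that a derivative is unique almost everywhere. As \<open>\<mu>\<close> need not be
  \<open>\<sigma>\<close>-finite, the Radon--Nikodym uniqueness theorem applies only locally, on a compact set, where
  \<open>\<mu>\<close> is finite. Inner regularity makes this enough (\<open>radon_density_unique\<close>): the set on which two
  densities differ contains no compact set of positive measure, and is therefore null.
\<close>

lemma (in algebraic_loop) bij_mul: "bij (mul a)"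
  using ex1_left_solution by (simp add: bij_iff)

lemma (in algebraic_loop) inv_mul: "inv (mul a) = loop_ldiv mul a"
proof
  fix b
  show "inv (mul a) b = loop_ldiv mul a b"
    unfolding loop_ldiv_def
    by (rule the1_equality[OF ex1_left_solution, symmetric])
      (simp add: bij_mul bij_is_surj surj_f_inv_f)
qed

lemma (in algebraic_loop) mul_comp_of_assoc_deviation_id:
  assumes "assoc_deviation mul a b = id"
  shows "mul (mul a b) = mul a \<circ> mul b"
proof -
  have "mul a \<circ> mul b = (mul a \<circ> mul b \<circ> inv (mul (mul a b))) \<circ> mul (mul a b)"
    using bij_mul[THEN bij_is_inj] by (simp add: comp_assoc)
  also have "\<dots> = mul (mul a b)"
    using assms by (simp add: assoc_deviation_def)
  finally show ?thesis ..
qed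

lemma (in topological_loop) borel_measurable_mul: "mul a \<in> borel_measurable borel"
proof (rule borel_measurable_continuous_onI)
  have "continuous_on UNIV ((\<lambda>(a, b). mul a b) \<circ> (\<lambda>x. (a, x)))"
    by (rule continuous_on_compose)
      (auto intro!: continuous_intros intro: continuous_on_subset[OF continuous_mul])
  then show "continuous_on UNIV (mul a)" by (simp add: o_def)
qed

lemma (in topological_loop) borel_measurable_inv_mul: "inv (mul a) \<in> borel_measurable borel"
  unfolding inv_mul
proof (rule borel_measurable_continuous_onI)
  have "continuous_on UNIV ((\<lambda>(a, b). loop_ldiv mul a b) \<circ> (\<lambda>x. (a, x)))"
    by (rule continuous_on_compose)
      (auto intro!: continuous_intros intro: continuous_on_subset[OF continuous_ldiv])
  then show "continuous_on UNIV (loop_ldiv mul a)" by (simp add: o_def)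
qed

text \<open>
  Restricted to a compact subset of the set where \<open>f\<close> and \<open>g\<close> differ, \<open>\<mu>\<close> is a finite measure, for
  which uniqueness of densities is classical; hence that compact set is null. Inner regularity
  passes this on to the whole set.
\<close>

lemma radon_density_unique:
  fixes \<mu> :: "'a::t2_space measure" and f g :: "'a \<Rightarrow> ennreal"
  assumes radon: "radon_measure \<mu>"
    and f: "f \<in> borel_measurable borel" and g: "g \<in> borel_measurable borel"
    and eq: "density \<mu> f = density \<mu> g"
  shows "AE x in \<mu>. f x = g x"
proof -
  have sets: "sets \<mu> = sets borel"
    and finite_compact: "\<And>K. compact K \<Longrightarrow> emeasure \<mu> K < \<infinity>"
    and inner: "\<And>B. B \<in> sets borel \<Longrightarrow>
      emeasure \<mu> B = (SUP K\<in>{K. compact K \<and> K \<subseteq> B}. emeasure \<mu> K)"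
    using radon by (auto simp: radon_measure_def)
  have space: "space \<mu> = UNIV"
    using sets_eq_imp_space_eq[OF sets] by simp
  have f_\<mu>[measurable]: "f \<in> borel_measurable \<mu>" and g_\<mu>[measurable]: "g \<in> borel_measurable \<mu>"
    using f g by (simp_all add: measurable_cong_sets[OF sets refl])
  let ?N = "{x. f x \<noteq> g x}"
  have "{x \<in> space \<mu>. f x \<noteq> g x} \<in> sets \<mu>"
    by measurable
  then have N: "?N \<in> sets borel"
    by (simp add: space sets)
  have compact_null: "emeasure \<mu> K = 0" if K: "compact K" "K \<subseteq> ?N" for K
  proof -
    have K_sets[measurable]: "K \<in> sets \<mu>"
      using K(1) by (simp add: sets borel_closed compact_imp_closed)
    let ?\<nu> = "density \<mu> (indicator K)"
    interpret finite_measure ?\<nu>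
      by (rule finite_measureI)
        (use finite_compact[OF K(1)] in \<open>simp add: emeasure_density space sets less_top nn_integral_indicator[OF K_sets]\<close>)
    have "density ?\<nu> h = density (density \<mu> h) (indicator K)"
      if [measurable]: "h \<in> borel_measurable \<mu>" for h :: "'a \<Rightarrow> ennreal"
      by (simp add: density_density_eq mult.commute)
    then have "density ?\<nu> f = density ?\<nu> g"
      using eq by simp
    then have "AE x in ?\<nu>. f x = g x"
      by (subst (asm) density_unique_iff) auto
    then have "AE x in \<mu>. x \<in> K \<longrightarrow> f x = g x"
      by (subst (asm) AE_density) (auto simp: indicator_def)
    then have "AE x in \<mu>. x \<notin> K"
      by eventually_elim (use K(2) in auto)
    then show ?thesis
      by (subst (asm) AE_iff_measurable[OF K_sets]) (auto simp: space)
  qed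
  have "emeasure \<mu> ?N = 0"
    unfolding inner[OF N] by (subst SUP_eq_const[where x = 0]) (auto intro: compact_null)
  then show ?thesis
    by (subst AE_iff_measurable[where N = "?N"]) (use N in \<open>auto simp: space sets\<close>)
qed

lemma distr_eq_density_of_pushforward_derivative:
  assumes sets: "sets \<mu> = sets borel" and r: "pushforward_derivative \<mu> f r"
  shows "distr \<mu> borel f = density \<mu> (\<lambda>x. ennreal (r x))"
proof (rule measure_eqI)
  fix E assume "E \<in> sets (distr \<mu> borel f)"
  moreover have "(\<lambda>x. ennreal (r x)) \<in> borel_measurable \<mu>"
    using r by (auto simp: pushforward_derivative_def measurable_cong_sets[OF sets refl])
  ultimately show "emeasure (distr \<mu> borel f) E = emeasure (density \<mu> (\<lambda>x. ennreal (r x))) E"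
    using r by (simp add: pushforward_derivative_def emeasure_density sets)
qed (simp add: sets)

text \<open>
  Pushing the density \<open>s\<close> of \<open>g\<^sub>*\<mu>\<close> forward along \<open>f\<close> transports it to \<open>s \<circ> f\<^sup>-\<^sup>1\<close>, now relative to
  \<open>f\<^sub>*\<mu>\<close>; the derivative \<open>r\<close> of \<open>f\<close> then converts it back to a density relative to \<open>\<mu>\<close>.
\<close>

lemma pushforward_derivative_comp:
  assumes sets: "sets \<mu> = sets borel"
    and f: "f \<in> borel_measurable borel" and g: "g \<in> borel_measurable borel"
    and inj: "inj f" and inv_f: "inv f \<in> borel_measurable borel"
    and r: "pushforward_derivative \<mu> f r" and s: "pushforward_derivative \<mu> g s"
  shows "pushforward_derivative \<mu> (f \<circ> g) (\<lambda>x. r x * s (inv f x))"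
proof -
  have r_meas[measurable]: "r \<in> borel_measurable borel" and r_pos: "\<And>x. 0 < r x"
    and s_meas[measurable]: "s \<in> borel_measurable borel" and s_pos: "\<And>x. 0 < s x"
    using r s by (auto simp: pushforward_derivative_def)
  note [measurable] = f g inv_f
  have \<mu>_cong: "h \<in> borel_measurable \<mu>" if "h \<in> borel_measurable borel" for h :: "_ \<Rightarrow> ennreal"
    using that by (simp add: measurable_cong_sets[OF sets refl])
  have f_\<mu>: "f \<in> measurable \<mu> borel" and g_\<mu>: "g \<in> measurable \<mu> borel"
    using f g by (simp_all add: measurable_cong_sets[OF sets refl])
  have "emeasure (distr \<mu> borel (f \<circ> g)) E = (\<integral>\<^sup>+x\<in>E. ennreal (r x * s (inv f x)) \<partial>\<mu>)"
    if E[measurable]: "E \<in> sets borel" for E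
  proof -
    have preE: "f -` E \<in> sets borel"
      using measurable_sets[OF f E] by simp
    have "emeasure (distr \<mu> borel (f \<circ> g)) E = emeasure (distr (distr \<mu> borel g) borel f) E"
      by (simp add: distr_distr[OF f g_\<mu>])
    also have "\<dots> = emeasure (distr \<mu> borel g) (f -` E)"
      by (simp add: emeasure_distr E)
    also have "\<dots> = (\<integral>\<^sup>+x\<in>f -` E. ennreal (s x) \<partial>\<mu>)"
      using s preE by (simp add: pushforward_derivative_def)
    also have "\<dots> = (\<integral>\<^sup>+x. ennreal (s (inv f (f x))) * indicator E (f x) \<partial>\<mu>)"
      using inj by (intro nn_integral_cong) (simp add: indicator_def)
    also have "\<dots> = (\<integral>\<^sup>+y. ennreal (s (inv f y)) * indicator E y \<partial>distr \<mu> borel f)"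
      by (rule nn_integral_distr[OF f_\<mu>, symmetric]) measurable
    also have "\<dots> = (\<integral>\<^sup>+y. ennreal (r y) * (ennreal (s (inv f y)) * indicator E y) \<partial>\<mu>)"
      unfolding distr_eq_density_of_pushforward_derivative[OF sets r]
      by (rule nn_integral_density; intro \<mu>_cong; measurable)
    also have "\<dots> = (\<integral>\<^sup>+x\<in>E. ennreal (r x * s (inv f x)) \<partial>\<mu>)"
      using r_pos s_pos by (simp add: ennreal_mult less_imp_le mult.assoc)
    finally show ?thesis .
  qed
  then show ?thesis
    using r_pos s_pos by (simp add: pushforward_derivative_def)
qed

theorem proposition5p1:
  fixes mul :: "'a::t2_space \<Rightarrow> 'a \<Rightarrow> 'a" and e :: 'a
    and \<mu> :: "'a measure"
    and lam :: "'a \<Rightarrow> 'a \<Rightarrow> real"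
    and I :: "(loop_term \<times> loop_term) set"
    and P :: "('a \<times> 'a) set"
  assumes "topological_loop mul e"
    and "locally_compact_space (euclidean :: 'a topology)"
    and "radon_measure \<mu>"
    and "left_quasi_invariant mul \<mu>"
    and "\<And>a. pushforward_derivative \<mu> (mul a) (lam a)"
    and "satisfies_identities mul e I"
    and "satisfies_identities mul e I \<Longrightarrow> \<forall>(a, b)\<in>P. assoc_deviation mul a b = id"
  shows "\<forall>(a, b)\<in>P. AE x in \<mu>. lam a x * lam b (inv (mul a) x) = lam (mul a b) x"
proof clarify
  fix a b assume "(a, b) \<in> P"
  interpret topological_loop mul e by fact
  have sets: "sets \<mu> = sets borel"
    using assms(3) by (simp add: radon_measure_def)
  let ?r = "\<lambda>x. lam a x * lam b (inv (mul a) x)"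
  have "mul (mul a b) = mul a \<circ> mul b"
    using assms(6,7) \<open>(a, b) \<in> P\<close> by (intro mul_comp_of_assoc_deviation_id) auto
  then have r: "pushforward_derivative \<mu> (mul (mul a b)) ?r"
    using pushforward_derivative_comp[OF sets borel_measurable_mul borel_measurable_mul
        bij_is_inj[OF bij_mul] borel_measurable_inv_mul assms(5) assms(5)]
    by simp
  note lam = assms(5)[of "mul a b"]
  have "density \<mu> (\<lambda>x. ennreal (?r x)) = density \<mu> (\<lambda>x. ennreal (lam (mul a b) x))"
    using distr_eq_density_of_pushforward_derivative[OF sets r]
      distr_eq_density_of_pushforward_derivative[OF sets lam] by simp
  moreover have "(\<lambda>x. ennreal (?r x)) \<in> borel_measurable borel"
    "(\<lambda>x. ennreal (lam (mul a b) x)) \<in> borel_measurable borel"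
    using r lam by (auto simp: pushforward_derivative_def)
  ultimately have "AE x in \<mu>. ennreal (?r x) = ennreal (lam (mul a b) x)"
    by (intro radon_density_unique[OF assms(3)])
  moreover have "0 \<le> ?r x" "0 \<le> lam (mul a b) x" for x
    using r lam by (simp_all add: pushforward_derivative_def less_imp_le)
  ultimately show "AE x in \<mu>. ?r x = lam (mul a b) x"
    by simp
qed

end
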